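(* Let $n, M, N\ge 1$ be integers and let $\mathscr{A}\colon\mathbb{R}^n\to\mathbb{R}^{M\times N}$ be any $\mathbb{R}^{M\times N}$-valued polynomial on $\mathbb{R}^n$. Let $\mathcal{R}_{\mathscr{A}}=\{\xi\in\mathbb{R}^n : \operatorname{rank}\mathscr{A}(\xi)\text{ is maximal}\}$. Then there exists an $\mathbb{R}^{N\times N}$-valued polynomial $\mathscr{B}$ on $\mathbb{R}^n$ such that $$\ker\mathscr{A}(\xi)=\operatorname{im}\mathscr{B}(\xi)\quad\text{for all }\xi\in\mathcal{R}_{\mathscr{A}}.$$ Moreover, if $\mathscr{A}$ has homogeneous rows, then $\mathscr{B}$ can be chosen to have the same homogeneity in every entry: if for each $i$ all the entries $\mathscr{A}_{ij}$ ($1\le j\le N$) of the $i$-th row are homogeneous of degree $h_i$, and $r$ is the generic rank of $\mathscr{A}$, then $\mathscr{B}$ (with the property that $\ker\mathscr{A}(\xi)=\operatorname{im}\mathscr{B}(\xi)$ for all $\xi\in\mathcal{R}_{\mathscr{A}}$) can be chosen to be $(2r\max_i h_i)$-homogeneous, i.e. with every entry homogeneous of degree $2r\max_i h_i$.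
   Context: An $\mathbb{R}^{M\times N}$-valued polynomial on $\mathbb{R}^n$ is a matrix $\mathscr{A}(\xi)=(\mathscr{A}_{ij}(\xi))_{1\le i\le M,\,1\le j\le N}$ whose entries are real polynomials in $\xi\in\mathbb{R}^n$. "Maximal" in the definition of $\mathcal{R}_{\mathscr{A}}$ means $\operatorname{rank}\mathscr{A}(\xi)=\max_{\eta\in\mathbb{R}^n}\operatorname{rank}\mathscr{A}(\eta)$; this maximum value is the generic rank $r$ of $\mathscr{A}$. The degrees $h_i$ are natural numbers ($0$ allowed), and the zero polynomial counts as homogeneous of every degree. $\ker$ and $\operatorname{im}$ denote the kernel and the image (both subspaces of $\mathbb{R}^N$ here) of the linear maps given by the matrices.
   Formalization: In the homogeneous part, ker A(ξ) = im B(ξ) is claimed at ξ = 0 only if 2r·max h_i = 0; otherwise B(0) = 0 is forced and the claim at 0 can fail, e.g. for n = 1 and A with rows (1,0), (ξ,0). *)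

theory Defs
  imports "HOL-Analysis.Analysis"
begin

definition matrix_polynomial :: "(real^'n \<Rightarrow> real^'k^'m) \<Rightarrow> bool"
  where "matrix_polynomial A \<longleftrightarrow> (\<forall>i j. real_polynomial_function (\<lambda>\<xi>. A \<xi> $ i $ j))"

text \<open>An exponent is a multi-index \<open>\<alpha> :: 'n \<Rightarrow> nat\<close>, and there are only finitely many of a given
  total degree. All coefficients may vanish, so \<open>0\<close> is homogeneous of every degree.\<close>

definition homogeneous_polynomial :: "nat \<Rightarrow> (real^'n \<Rightarrow> real) \<Rightarrow> bool"
  where "homogeneous_polynomial d p \<longleftrightarrow>
    (\<exists>c. p = (\<lambda>\<xi>. \<Sum>\<alpha> | (\<Sum>i\<in>UNIV. \<alpha> i) = d. c \<alpha> * (\<Prod>i\<in>UNIV. (\<xi> $ i) ^ \<alpha> i)))"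

definition generic_rank :: "(real^'n \<Rightarrow> real^'k^'m) \<Rightarrow> nat"
  where "generic_rank A = Max (range (\<lambda>\<eta>. rank (A \<eta>)))"

definition max_rank_set :: "(real^'n \<Rightarrow> real^'k^'m) \<Rightarrow> (real^'n) set"
  where "max_rank_set A = {\<xi>. rank (A \<xi>) = generic_rank A}"

lemma finite_range_rank: "finite (range (\<lambda>\<eta>. rank (A \<eta> :: real^'k^'m)))"
  by (rule finite_subset[of _ "{..min CARD('m) CARD('k)}"]) (auto simp: rank_bound[simplified])

lemma finite_multi_indices: "finite {\<alpha> :: 'n::finite \<Rightarrow> nat. (\<Sum>i\<in>UNIV. \<alpha> i) = d}"
proof (rule finite_subset)
  show "{\<alpha> :: 'n \<Rightarrow> nat. (\<Sum>i\<in>UNIV. \<alpha> i) = d} \<subseteq> Pi\<^sub>E UNIV (\<lambda>_. {..d})"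
    by (auto simp: PiE_def Pi_def intro!: member_le_sum)
  show "finite (Pi\<^sub>E (UNIV :: 'n set) (\<lambda>_. {..d}))"
    by (rule finite_PiE) auto
qed

lemma homogeneous_polynomial_imp_real_polynomial_function:
  assumes "homogeneous_polynomial d p"
  shows "real_polynomial_function p"
proof -
  have "real_polynomial_function (\<lambda>\<xi> :: real^'n. \<xi> $ i)" for i
    by (intro real_polynomial_function.intros(1) bounded_linear_vec_nth)
  then show ?thesis
    using assms unfolding homogeneous_polynomial_def
    by (auto intro!: real_polynomial_function_sum real_polynomial_function.intros(4)
        real_polynomial_function_prod real_polynomial_function_power simp: finite_multi_indices)
qed

lemma homogeneous_polynomial_scaleR:
  assumes "homogeneous_polynomial d p"
  shows "p (t *\<^sub>R \<xi>) = t ^ d * p \<xi>"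
  using assms unfolding homogeneous_polynomial_def
  by (auto simp: sum_distrib_left power_mult_distrib prod.distrib power_sum mult_ac intro!: sum.cong)

lemma homogeneous_polynomial_at_0:
  assumes "homogeneous_polynomial d p" "d > 0"
  shows "p 0 = 0"
  using homogeneous_polynomial_scaleR[OF assms(1), of 0 0] assms(2) by (simp add: zero_power)

text \<open>If \<open>\<B>\<close> is homogeneous of positive degree, then \<open>\<B>(0) = 0\<close>. So if \<open>0\<close> is a point of maximal
  rank, which can happen when the degrees of the rows differ, then \<open>ker \<A>(0) = im \<B>(0)\<close> fails
  unless \<open>ker \<A>(0)\<close> is trivial. The matrix with rows \<open>(1, 0)\<close> and \<open>(\<xi>, 0)\<close> shows that this
  does happen.\<close>

lemma homogeneous_kernel_fails_at_0:
  "\<exists>(A :: real^1 \<Rightarrow> real^2^2) h.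
     matrix_polynomial A \<and>
     (\<forall>i j. homogeneous_polynomial (h i) (\<lambda>\<xi>. A \<xi> $ i $ j)) \<and>
     \<not> (\<exists>B :: real^1 \<Rightarrow> real^2^2. matrix_polynomial B \<and>
          (\<forall>\<xi>\<in>max_rank_set A. {v. A \<xi> *v v = 0} = range ((*v) (B \<xi>))) \<and>
          (\<forall>i j. homogeneous_polynomial (2 * generic_rank A * Max (range h)) (\<lambda>\<xi>. B \<xi> $ i $ j)))"
proof -
  define A :: "real^1 \<Rightarrow> real^2^2"
    where "A = (\<lambda>\<xi>. \<chi> i j. if j = 1 then (if i = 1 then 1 else \<xi> $ 1) else 0)"
  define h :: "2 \<Rightarrow> nat" where "h = (\<lambda>i. if i = 1 then 0 else 1)"
  have A_mult: "A \<xi> *v axis 2 1 = 0" for \<xi>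
    by (simp add: A_def vec_eq_iff matrix_vector_mult_def axis_def sum_2)
  have "rank (A \<xi>) = 1" for \<xi>
  proof -
    have "A \<xi> $ 1 $ 1 \<noteq> 0"
      by (simp add: A_def)
    then have "rank (A \<xi>) \<noteq> 0"
      by (metis rank_eq_0 zero_index)
    moreover have "(axis 2 1 :: real^2) \<noteq> 0"
      by (simp add: axis_eq_0_iff)
    with A_mult[of \<xi>] have "rank (A \<xi>) \<noteq> CARD(2)"
      using matrix_nonfull_linear_equations_eq[of "A \<xi>"] by metis
    moreover have "rank (A \<xi>) \<le> CARD(2)"
      using rank_bound[of "A \<xi>"] by simp
    ultimately show ?thesis
      by simp
  qed
  then have r: "generic_rank A = 1" and R: "max_rank_set A = UNIV"
    by (simp_all add: generic_rank_def max_rank_set_def)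
  have "range h = {0, 1}"
    by (simp add: h_def UNIV_2 insert_commute)
  then have M: "Max (range h) = 1"
    by simp
  have idx: "{\<alpha> :: 1 \<Rightarrow> nat. \<alpha> 1 = d} = {\<lambda>_. d}" for d
    by (auto simp: fun_eq_iff)
  have hom: "homogeneous_polynomial d (\<lambda>\<xi> :: real^1. c * (\<xi> $ 1) ^ d)" for d c
    unfolding homogeneous_polynomial_def
    by (rule exI[of _ "\<lambda>_. c"]) (simp add: UNIV_1 idx)
  have hA: "homogeneous_polynomial (h i) (\<lambda>\<xi>. A \<xi> $ i $ j)" for i j
    using hom[of "h i" "if j = 1 then 1 else 0"] by (auto simp: A_def h_def split: if_splits)
  have "matrix_polynomial A"
    unfolding matrix_polynomial_def
    using hA homogeneous_polynomial_imp_real_polynomial_function by blast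
  moreover have False
    if ker: "\<forall>\<xi>\<in>max_rank_set A. {v. A \<xi> *v v = 0} = range ((*v) (B \<xi>))"
      and B: "\<forall>i j. homogeneous_polynomial (2 * generic_rank A * Max (range h)) (\<lambda>\<xi>. B \<xi> $ i $ j)"
    for B :: "real^1 \<Rightarrow> real^2^2"
  proof -
    have "B 0 $ i $ j = 0" for i j
      using homogeneous_polynomial_at_0[OF B[rule_format, of i j]] by (simp add: r M)
    then have "B 0 = 0"
      by (simp add: vec_eq_iff)
    moreover have "axis 2 1 \<in> range ((*v) (B 0))"
      using ker A_mult R by blast
    ultimately show False
      by (auto simp: axis_eq_0_iff)
  qed
  ultimately show ?thesis
    using hA by blast
qed

end

theory Submission
  imports Defs
begin

text \<open>The matrix \<open>B\<close> is a weighted sum of Cramer solutions of the system \<open>A v = 0\<close>, one for each choice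
  of \<open>r\<close> rows and \<open>r\<close> columns, with \<open>r\<close> the generic rank.

  Choose a set \<open>J\<close> of \<open>r\<close> columns and a map \<open>f\<close> from column indices to row indices. Let \<open>M\<close> be the
  square matrix whose \<open>j\<close>-th row is row \<open>f j\<close> of \<open>A\<close> if \<open>j \<in> J\<close> and the \<open>j\<close>-th unit vector
  otherwise (\<open>row_completion\<close>), so that \<open>det M\<close> is, up to sign, an \<open>r \<times> r\<close> minor of \<open>A\<close>. Let \<open>E\<close> be
  the diagonal projection that kills the coordinates in \<open>J\<close>, and let \<open>C = adj(M) E\<close>
  (\<open>cramer_matrix\<close>). Suppose \<open>A\<close> has rank \<open>r\<close> at the point considered and \<open>det M \<noteq> 0\<close>. Since
  \<open>M C = det M E\<close>, the columns of \<open>C\<close> are orthogonal to the chosen rows, which span the row space, so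
  \<open>A C = 0\<close>. Conversely, \<open>A v = 0\<close> gives \<open>M v = E v\<close>, hence \<open>C v = det M v\<close>. Multiplying \<open>C\<close> by
  \<open>det M\<close> gives a matrix with both properties for singular \<open>M\<close> too, and it acts on \<open>ker A\<close> as
  the scalar \<open>(det M)\<^sup>2 \<ge> 0\<close>.

  Now sum over all \<open>f\<close> and \<open>J\<close>, with positive weights. The image of the sum lies in \<open>ker A\<close>, and on
  \<open>ker A\<close> the sum is multiplication by a weighted sum of squares of minors, which is positive
  because a matrix of rank \<open>r\<close> has a nonzero \<open>r \<times> r\<close> minor. So the image is all of \<open>ker A\<close>
  (\<open>kernel_eq_range_kernel_matrix\<close>).

  The entries are polynomials in those of \<open>A\<close>. If row \<open>i\<close> of \<open>A\<close> is homogeneous of degree \<open>h i\<close>,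
  then \<open>det M\<close> and \<open>C\<close> are both homogeneous of degree \<open>\<Sum>j\<in>J. h (f j)\<close>, since a unit row
  contributes degree \<open>0\<close>. The defect to \<open>2 r max h\<close> is therefore even and is filled by
  the weight, a power of \<open>|\<xi>|\<^sup>2\<close>, which is positive for \<open>\<xi> \<noteq> 0\<close>.\<close>

section \<open>Cramer solutions of a homogeneous linear system\<close>

text \<open>Completing the selected rows by unit rows, instead of cutting out a submatrix, keeps every matrix
  square with the same index type whatever the size of \<open>J\<close>. If \<open>f\<close> repeats
  a row on \<open>J\<close>, the determinant vanishes, so sums may run over all maps \<open>f\<close>.\<close>

definition row_completion :: "real^'k^'m \<Rightarrow> ('k \<Rightarrow> 'm) \<Rightarrow> 'k set \<Rightarrow> real^'k^'k"
  where "row_completion A f J = (\<chi> i. if i \<in> J then A $ f i else axis i 1)"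

text \<open>Cramer's rule with the unit vector \<open>axis l 1\<close>, or \<open>0\<close> if \<open>l \<in> J\<close>, as right-hand side of the
  \<open>l\<close>-th column: this is the adjugate of \<open>row_completion A f J\<close> with the columns in \<open>J\<close> set to zero.\<close>

definition cramer_matrix :: "real^'k^'m \<Rightarrow> ('k \<Rightarrow> 'm) \<Rightarrow> 'k set \<Rightarrow> real^'k^'k"
  where "cramer_matrix A f J =
    (\<chi> k l. det (\<chi> i j. if j = k then if i = l \<and> i \<notin> J then 1 else 0
                        else row_completion A f J $ i $ j))"

definition kernel_matrix :: "(('k \<Rightarrow> 'm) \<Rightarrow> 'k set \<Rightarrow> real) \<Rightarrow> nat \<Rightarrow> real^'k^'m \<Rightarrow> real^'k^'k"
  where "kernel_matrix w r A =
    (\<chi> k l. \<Sum>(f, J) \<in> UNIV \<times> {J. card J = r}.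
        w f J * det (row_completion A f J) * cramer_matrix A f J $ k $ l)"

lemma row_completion_mult_vec:
  "row_completion A f J *v x = (\<chi> i. if i \<in> J then A $ f i \<bullet> x else x $ i)"
  by (simp add: row_completion_def vec_eq_iff matrix_vector_mul_component inner_axis_axis
      inner_commute[of "axis _ _"] cart_eq_inner_axis[symmetric])

text \<open>This is \<open>M adj(M) = det M\<close> restricted to the coordinates outside \<open>J\<close>. It is what makes the
  selected rows of \<open>A\<close> annihilate the range of the Cramer matrix.\<close>

lemma row_completion_mult_cramer_vec:
  assumes "det (row_completion A f J) \<noteq> 0"
  shows "row_completion A f J *v (cramer_matrix A f J *v x) =
    det (row_completion A f J) *\<^sub>R (\<chi> i. if i \<in> J then 0 else x $ i)"
proof -
  let ?M = "row_completion A f J"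
  let ?E = "\<lambda>l. \<chi> i. if i = l \<and> i \<notin> J then 1 else (0::real)"
  obtain N where inv: "?M ** N = mat 1"
    using assms by (auto simp: invertible_det_nz[symmetric] invertible_right_inverse)
  have col: "column l (cramer_matrix A f J) = det ?M *\<^sub>R (N *v ?E l)" for l
  proof -
    have "cramer_matrix A f J $ k $ l = (N *v ?E l) $ k * det ?M" for k
    proof -
      have "?M *v (N *v ?E l) = ?E l"
        using inv by (simp add: matrix_vector_mul_assoc)
      from cramer_lemma[of k ?M "N *v ?E l", unfolded this] show ?thesis
        by (simp add: cramer_matrix_def cong: if_cong)
    qed
    then show ?thesis
      by (simp add: vec_eq_iff column_def)
  qed
  have "?M *v (cramer_matrix A f J *v x) = (\<Sum>l\<in>UNIV. x $ l *\<^sub>R (?M *v column l (cramer_matrix A f J)))"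
    by (simp add: matrix_mult_sum[of "cramer_matrix A f J"] scalar_mult_eq_scaleR
        linear_sum[OF matrix_vector_mul_linear] linear_cmul[OF matrix_vector_mul_linear])
  also have "\<dots> = (\<Sum>l\<in>UNIV. x $ l *\<^sub>R (det ?M *\<^sub>R ?E l))"
    using inv by (simp add: col linear_cmul[OF matrix_vector_mul_linear] matrix_vector_mul_assoc)
  also have "\<dots> = det ?M *\<^sub>R (\<chi> i. if i \<in> J then 0 else x $ i)"
    by (auto simp: vec_eq_iff if_distrib[of "\<lambda>x. _ * x"] cong: if_cong)
  finally show ?thesis .
qed

text \<open>On \<open>ker A\<close> the product \<open>M x\<close> merely erases the coordinates in \<open>J\<close>, so \<open>adj(M) E x = adj(M) M x\<close>.\<close>

lemma cramer_matrix_mult_kernel: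
  assumes "det (row_completion A f J) \<noteq> 0" and "A *v x = 0"
  shows "cramer_matrix A f J *v x = det (row_completion A f J) *\<^sub>R x"
proof -
  let ?M = "row_completion A f J"
  have "A $ i \<bullet> x = 0" for i
    using assms(2) by (metis matrix_vector_mul_component zero_index)
  then have "?M *v x = (\<chi> i. if i \<in> J then 0 else x $ i)"
    by (auto simp: row_completion_mult_vec vec_eq_iff)
  then have "?M *v (cramer_matrix A f J *v x) = ?M *v (det ?M *\<^sub>R x)"
    by (simp only: row_completion_mult_cramer_vec[OF assms(1)] linear_cmul[OF matrix_vector_mul_linear])
  moreover have "inj ((*v) ?M)"
    using assms(1) by (simp add: det_eq_0_rank less_rank_noninjective)
  ultimately show ?thesis
    by (simp add: inj_eq)
qed

text \<open>A nonzero minor of maximal size certifies that its rows are linearly independent, and there are as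
  many of them as the dimension of the row space.\<close>

lemma row_in_span_selected_rows:
  fixes A :: "real^'k^'m"
  assumes det: "det (row_completion A f J) \<noteq> 0" and card: "card J = rank A"
  shows "A $ i \<in> span ((\<lambda>j. A $ f j) ` J)"
proof -
  let ?M = "row_completion A f J"
  have rowsM: "rows ?M = range (($) ?M)" and rowsA: "rows A = range (($) A)"
    by (auto simp: rows_def row_def)
  have "dim (range (($) ?M)) = CARD('k)"
    using det rank_bound[of ?M] by (simp add: det_eq_0_rank row_rank_def rowsM)
  moreover have "card (range (($) ?M)) \<le> CARD('k)"
    by (rule card_image_le) simp
  moreover have "dim (range (($) ?M)) \<le> card (range (($) ?M))"
    by (rule dim_le_card) (auto intro: span_base)
  ultimately have card_eq: "card (range (($) ?M)) = CARD('k)"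
    and indep: "independent (range (($) ?M))"
    using card_le_dim_spanning[of "range (($) ?M)" "range (($) ?M)"]
    by (auto intro: span_base)
  have inj: "inj (($) ?M)"
    using card_eq by (simp add: eq_card_imp_inj_on)
  have img: "(\<lambda>j. A $ f j) ` J = ($) ?M ` J"
    by (auto simp: row_completion_def image_def)
  have "independent ((\<lambda>j. A $ f j) ` J)"
    unfolding img by (rule independent_mono[OF indep]) auto
  moreover have "card ((\<lambda>j. A $ f j) ` J) = dim (range (($) A))"
    unfolding img using inj card
    by (simp add: card_image inj_on_subset row_rank_def rowsA)
  ultimately have "range (($) A) \<subseteq> span ((\<lambda>j. A $ f j) ` J)"
    by (intro card_ge_dim_independent) auto
  then show ?thesis
    by blast
qed

lemma cramer_matrix_range_in_kernel:
  assumes det: "det (row_completion A f J) \<noteq> 0" and card: "card J = rank A"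
  shows "A *v (cramer_matrix A f J *v x) = 0"
proof -
  let ?y = "cramer_matrix A f J *v x"
  have "A $ f j \<bullet> ?y = 0" if "j \<in> J" for j
    using row_completion_mult_vec[of A f J ?y] row_completion_mult_cramer_vec[OF det, of x] that
    by (auto simp: vec_eq_iff split: if_splits)
  then have "orthogonal ?y v" if "v \<in> (\<lambda>j. A $ f j) ` J" for v
    using that by (auto simp: orthogonal_def inner_commute)
  then have "orthogonal ?y (A $ i)" for i
    using orthogonal_to_span[OF row_in_span_selected_rows[OF det card]] by blast
  then show ?thesis
    by (simp add: vec_eq_iff matrix_vector_mul_component orthogonal_def inner_commute)
qed

text \<open>Steinitz exchange: a basis \<open>S\<close> of the row space made of rows of \<open>A\<close> extends to a basis \<open>T\<close> of the
  whole space by unit vectors. The indices of the unit vectors that were not added form \<open>J\<close>; there are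
  exactly as many of them as there are rows in \<open>S\<close>, so these rows can be placed there.\<close>

lemma exists_row_completion_det_nz:
  fixes A :: "real^'k^'m"
  shows "\<exists>f J. card J = rank A \<and> det (row_completion A f J) \<noteq> 0"
proof -
  have rowsA: "rows A = range (($) A)"
    by (auto simp: rows_def row_def)
  obtain S where S: "S \<subseteq> range (($) A)" "independent S" "card S = rank A"
    using basis_exists[of "range (($) A)"] by (metis row_rank_def rowsA)
  let ?B = "range (\<lambda>i. axis i 1) :: (real^'k) set"
  have "Basis = ?B"
    by (auto simp: Basis_vec_def)
  then have spanB: "span ?B = UNIV"
    by (metis span_Basis)
  obtain T where T: "S \<subseteq> T" "T \<subseteq> S \<union> ?B" "independent T" "S \<union> ?B \<subseteq> span T"
    using maximal_independent_subset_extend[of S "S \<union> ?B"] S(2) by blast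
  have spanT: "span T = UNIV"
    using T(4) spanB by (metis Un_subset_iff span_minimal subspace_span top.extremum_uniqueI)
  have finT: "finite T"
    using T(3) by (rule independent_imp_finite)
  have cardT: "card T = CARD('k)"
    using T(3) spanT by (metis basis_card_eq_dim dim_UNIV DIM_cart DIM_real mult.right_neutral subset_UNIV top_greatest)
  (* A unit vector may already lie in S; its index then belongs to J, since only the
     vectors added to S occupy their own row. *)
  define J where "J = {i. axis i 1 \<notin> T - S}"
  have "T - S = (\<lambda>i. axis i 1) ` (- J)"
    using T(2) by (auto simp: J_def)
  moreover have "inj (\<lambda>i. axis i 1 :: real^'k)"
    by (auto simp: inj_on_def axis_eq_axis)
  ultimately have "card (T - S) = card (- J)"
    by (simp add: card_image inj_on_subset)
  then have cardJ: "card J = card S"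
    using card_Diff_subset[of S T] finite_subset[OF T(1) finT] T(1) cardT card_mono[OF finT T(1)]
      card_mono[of UNIV J]
    by (simp add: Compl_eq_Diff_UNIV card_Diff_subset)
  then obtain b where b: "bij_betw b J S"
    using finite_same_card_bij[of J S] finite_subset[OF T(1) finT] by auto
  define f where "f i = (SOME m. A $ m = b i)" for i
  have f: "A $ f i = b i" if "i \<in> J" for i
  proof -
    have "b i \<in> range (($) A)"
      using b S(1) that by (auto simp: bij_betw_def)
    then have "\<exists>m. A $ m = b i"
      by auto
    then show ?thesis
      unfolding f_def by (rule someI_ex)
  qed
  let ?M = "row_completion A f J"
  have "T \<subseteq> rows ?M"
  proof
    fix v assume "v \<in> T"
    show "v \<in> rows ?M"
    proof (cases "v \<in> S")
      case True
      then obtain j where "j \<in> J" "b j = v"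
        using b by (auto simp: bij_betw_def)
      then have "row j ?M = v"
        by (simp add: row_def row_completion_def f)
      then show ?thesis
        by (auto simp: rows_def)
    next
      case False
      with \<open>v \<in> T\<close> T(2) obtain i where i: "v = axis i 1" "i \<notin> J"
        by (auto simp: J_def)
      then have "row i ?M = v"
        by (simp add: row_def row_completion_def)
      then show ?thesis
        by (auto simp: rows_def)
    qed
  qed
  then have "span (rows ?M) = UNIV"
    using spanT by (metis span_mono top.extremum_uniqueI)
  then have "det ?M \<noteq> 0"
    by (simp add: invertible_det_nz[symmetric] invertible_left_inverse matrix_left_invertible_span_rows)
  then show ?thesis
    using cardJ S(3) by metis
qed

section \<open>The kernel as an image\<close>

lemma kernel_matrix_mult_vec:
  fixes A :: "real^'k^'m"
  shows "kernel_matrix w r A *v x = (\<Sum>(f, J) \<in> UNIV \<times> {J. card J = r}.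
      (w f J * det (row_completion A f J)) *\<^sub>R (cramer_matrix A f J *v x))"
proof (subst vec_eq_iff, rule allI)
  fix k
  let ?I = "UNIV \<times> {J. card J = r} :: (('k \<Rightarrow> 'm) \<times> 'k set) set"
  let ?c = "\<lambda>f J. w f J * det (row_completion A f J)"
  have "(kernel_matrix w r A *v x) $ k =
      (\<Sum>l\<in>UNIV. \<Sum>(f, J)\<in>?I. ?c f J * cramer_matrix A f J $ k $ l * x $ l)"
    by (simp add: kernel_matrix_def matrix_vector_mult_def sum_distrib_right split_def)
  also have "\<dots> = (\<Sum>(f, J)\<in>?I. \<Sum>l\<in>UNIV. ?c f J * cramer_matrix A f J $ k $ l * x $ l)"
    unfolding split_def by (rule sum.swap)
  also have "\<dots> = (\<Sum>(f, J)\<in>?I. ?c f J *\<^sub>R (cramer_matrix A f J *v x)) $ k"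
    by (simp add: matrix_vector_mult_def sum_distrib_left split_def mult.assoc)
  finally show "(kernel_matrix w r A *v x) $ k =
      (\<Sum>(f, J)\<in>?I. ?c f J *\<^sub>R (cramer_matrix A f J *v x)) $ k" .
qed

text \<open>The kernel matrix acts on \<open>ker A\<close> as a positive scalar, so \<open>ker A\<close> lies in its range. The other
  inclusion holds summand by summand, the factor \<open>det M\<close> removing the summands with singular \<open>M\<close>.\<close>

lemma kernel_eq_range_kernel_matrix:
  fixes A :: "real^'k^'m"
  assumes w: "\<And>f J. card J = rank A \<Longrightarrow> w f J > 0"
  shows "{v. A *v v = 0} = range ((*v) (kernel_matrix w (rank A) A))"
proof (rule antisym)
  let ?I = "UNIV \<times> {J. card J = rank A} :: (('k \<Rightarrow> 'm) \<times> 'k set) set"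
  let ?d = "\<lambda>f J. det (row_completion A f J)"
  let ?s = "\<Sum>(f, J)\<in>?I. w f J * (?d f J)\<^sup>2"
  show "{v. A *v v = 0} \<subseteq> range ((*v) (kernel_matrix w (rank A) A))"
  proof
    fix v assume "v \<in> {v. A *v v = 0}"
    then have v: "A *v v = 0" by simp
    have "(w f J * ?d f J) *\<^sub>R (cramer_matrix A f J *v v) = (w f J * (?d f J)\<^sup>2) *\<^sub>R v" for f J
      using cramer_matrix_mult_kernel[OF _ v, of f J]
      by (cases "?d f J = 0") (simp_all add: power2_eq_square)
    then have "kernel_matrix w (rank A) A *v v = (\<Sum>(f, J)\<in>?I. (w f J * (?d f J)\<^sup>2) *\<^sub>R v)"
      unfolding kernel_matrix_mult_vec by simp
    then have eq: "kernel_matrix w (rank A) A *v v = ?s *\<^sub>R v"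
      by (simp add: scaleR_sum_left split_def)
    obtain f J where fJ: "card J = rank A" "?d f J \<noteq> 0"
      using exists_row_completion_det_nz[of A] by blast
    have "0 < ?s"
      by (rule sum_pos2[of _ "(f, J)"]) (use fJ w in \<open>auto intro!: mult_nonneg_nonneg simp: less_imp_le\<close>)
    then have "v = kernel_matrix w (rank A) A *v ((1 / ?s) *\<^sub>R v)"
      by (simp add: eq linear_cmul[OF matrix_vector_mul_linear])
    then show "v \<in> range ((*v) (kernel_matrix w (rank A) A))"
      by blast
  qed
  show "range ((*v) (kernel_matrix w (rank A) A)) \<subseteq> {v. A *v v = 0}"
  proof (clarify)
    fix x
    have "A *v ((w f J * ?d f J) *\<^sub>R (cramer_matrix A f J *v x)) = 0" if "card J = rank A" for f J
      using cramer_matrix_range_in_kernel[OF _ that, of f x]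
      by (cases "?d f J = 0") (auto simp: linear_cmul[OF matrix_vector_mul_linear])
    then show "A *v (kernel_matrix w (rank A) A *v x) = 0"
      unfolding kernel_matrix_mult_vec
      by (auto simp: linear_sum[OF matrix_vector_mul_linear] intro!: sum.neutral)
  qed
qed

section \<open>Calculus of homogeneous polynomials\<close>

lemma homogeneous_polynomial_0: "homogeneous_polynomial d (\<lambda>\<xi>. 0)"
  unfolding homogeneous_polynomial_def by (rule exI[of _ "\<lambda>_. 0"]) simp

lemma homogeneous_polynomial_add:
  assumes "homogeneous_polynomial d p" "homogeneous_polynomial d q"
  shows "homogeneous_polynomial d (\<lambda>\<xi>. p \<xi> + q \<xi>)"
proof -
  from assms obtain a b where
    "p = (\<lambda>\<xi>. \<Sum>\<alpha> | (\<Sum>i\<in>UNIV. \<alpha> i) = d. a \<alpha> * (\<Prod>i\<in>UNIV. (\<xi> $ i) ^ \<alpha> i))"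
    "q = (\<lambda>\<xi>. \<Sum>\<alpha> | (\<Sum>i\<in>UNIV. \<alpha> i) = d. b \<alpha> * (\<Prod>i\<in>UNIV. (\<xi> $ i) ^ \<alpha> i))"
    unfolding homogeneous_polynomial_def by blast
  then show ?thesis
    unfolding homogeneous_polynomial_def
    by (intro exI[of _ "\<lambda>\<alpha>. a \<alpha> + b \<alpha>"]) (simp add: sum.distrib distrib_right)
qed

lemma homogeneous_polynomial_sum:
  assumes "\<And>x. x \<in> S \<Longrightarrow> homogeneous_polynomial d (p x)"
  shows "homogeneous_polynomial d (\<lambda>\<xi>. \<Sum>x\<in>S. p x \<xi>)"
  using assms
  by (induction S rule: infinite_finite_induct)
    (auto intro: homogeneous_polynomial_0 homogeneous_polynomial_add)

lemma homogeneous_polynomial_monomial: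
  fixes \<alpha> :: "'n::finite \<Rightarrow> nat"
  assumes "(\<Sum>i\<in>UNIV. \<alpha> i) = d"
  shows "homogeneous_polynomial d (\<lambda>\<xi> :: real^'n. c * (\<Prod>i\<in>UNIV. (\<xi> $ i) ^ \<alpha> i))"
  unfolding homogeneous_polynomial_def
  by (rule exI[of _ "\<lambda>\<beta>. if \<beta> = \<alpha> then c else 0"])
    (use assms in \<open>simp add: if_distrib[of "\<lambda>x. x * _"] finite_multi_indices cong: if_cong\<close>)

lemma homogeneous_polynomial_const: "homogeneous_polynomial 0 (\<lambda>\<xi>. c)"
  using homogeneous_polynomial_monomial[of "\<lambda>_. 0" 0 c] by simp

lemma homogeneous_polynomial_mult:
  assumes "homogeneous_polynomial d p" "homogeneous_polynomial e q"
  shows "homogeneous_polynomial (d + e) (\<lambda>\<xi>. p \<xi> * q \<xi>)"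
proof -
  from assms obtain a b where
    p: "p = (\<lambda>\<xi>. \<Sum>\<alpha> | (\<Sum>i\<in>UNIV. \<alpha> i) = d. a \<alpha> * (\<Prod>i\<in>UNIV. (\<xi> $ i) ^ \<alpha> i))" and
    q: "q = (\<lambda>\<xi>. \<Sum>\<alpha> | (\<Sum>i\<in>UNIV. \<alpha> i) = e. b \<alpha> * (\<Prod>i\<in>UNIV. (\<xi> $ i) ^ \<alpha> i))"
    unfolding homogeneous_polynomial_def by blast
  have "(\<lambda>\<xi>. p \<xi> * q \<xi>) = (\<lambda>\<xi>. \<Sum>\<alpha> | (\<Sum>i\<in>UNIV. \<alpha> i) = d. \<Sum>\<beta> | (\<Sum>i\<in>UNIV. \<beta> i) = e.
      (a \<alpha> * b \<beta>) * (\<Prod>i\<in>UNIV. (\<xi> $ i) ^ (\<alpha> i + \<beta> i)))"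
    unfolding p q by (simp add: sum_product power_add prod.distrib mult_ac)
  then show ?thesis
    by (auto intro!: homogeneous_polynomial_sum homogeneous_polynomial_monomial simp: sum.distrib)
qed

lemma homogeneous_polynomial_prod:
  assumes "\<And>x. x \<in> S \<Longrightarrow> homogeneous_polynomial (d x) (p x)"
  shows "homogeneous_polynomial (\<Sum>x\<in>S. d x) (\<lambda>\<xi>. \<Prod>x\<in>S. p x \<xi>)"
  using assms
  by (induction S rule: infinite_finite_induct)
    (auto intro: homogeneous_polynomial_const homogeneous_polynomial_mult)

lemma homogeneous_polynomial_norm_power:
  "homogeneous_polynomial (2 * m) (\<lambda>\<xi> :: real^'n. ((norm \<xi>)\<^sup>2) ^ m)"
proof -
  have "homogeneous_polynomial 1 (\<lambda>\<xi> :: real^'n. \<xi> $ i)" for i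
  proof -
    have "(\<Prod>j\<in>UNIV. (\<xi> $ j) ^ (if j = i then 1 else 0)) = \<xi> $ i" for \<xi> :: "real^'n"
      by (simp add: if_distrib[of "\<lambda>x. _ ^ x"] cong: if_cong)
    with homogeneous_polynomial_monomial[of "\<lambda>j. if j = i then 1 else 0" 1 1] show ?thesis
      by simp
  qed
  then have "homogeneous_polynomial 2 (\<lambda>\<xi> :: real^'n. \<Sum>i\<in>UNIV. \<xi> $ i * \<xi> $ i)"
    by (intro homogeneous_polynomial_sum)
      (metis homogeneous_polynomial_mult one_add_one)
  then have "homogeneous_polynomial 2 (\<lambda>\<xi> :: real^'n. (norm \<xi>)\<^sup>2)"
    by (simp add: power2_norm_eq_inner inner_vec_def)
  with homogeneous_polynomial_prod[of "{..<m}" "\<lambda>_. 2" "\<lambda>_ \<xi>. (norm \<xi>)\<^sup>2"] show ?thesis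
    by (simp add: mult.commute)
qed

section \<open>Degrees of the kernel matrix\<close>

lemma real_polynomial_function_det:
  assumes "\<And>i j. real_polynomial_function (\<lambda>\<xi>. M \<xi> $ i $ j)"
  shows "real_polynomial_function (\<lambda>\<xi>. det (M \<xi> :: real^'k^'k))"
  unfolding det_def
  by (intro real_polynomial_function_sum real_polynomial_function.intros
      real_polynomial_function_prod assms finite_permutations finite)

text \<open>Each term of the Leibniz formula takes exactly one entry from every row, so only the degrees
  of the rows matter.\<close>

lemma homogeneous_polynomial_det:
  assumes "\<And>i j. homogeneous_polynomial (d i) (\<lambda>\<xi>. M \<xi> $ i $ j)"
  shows "homogeneous_polynomial (\<Sum>i\<in>UNIV. d i) (\<lambda>\<xi>. det (M \<xi> :: real^'k^'k))"
  unfolding det_def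
  by (intro homogeneous_polynomial_sum
      homogeneous_polynomial_mult[OF homogeneous_polynomial_const homogeneous_polynomial_prod, simplified]
      assms)

lemma matrix_polynomial_kernel_matrix:
  fixes A :: "real^'n \<Rightarrow> real^'k^'m"
  assumes "matrix_polynomial A"
  shows "matrix_polynomial (\<lambda>\<xi>. kernel_matrix (\<lambda>_ _. 1) r (A \<xi>))"
proof -
  have M: "real_polynomial_function (\<lambda>\<xi>. row_completion (A \<xi>) f J $ i $ j)" for f J i j
    using assms by (cases "i \<in> J")
      (simp_all add: row_completion_def matrix_polynomial_def real_polynomial_function.intros(2))
  have entry: "real_polynomial_function
      (\<lambda>\<xi>. if j = k then if i = l \<and> i \<notin> J then 1 else 0 else row_completion (A \<xi>) f J $ i $ j)" for f J i j k l
    using M by (cases "j = k") (simp_all add: real_polynomial_function.intros(2))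
  have "real_polynomial_function (\<lambda>\<xi>. cramer_matrix (A \<xi>) f J $ k $ l)" for f J k l
    unfolding cramer_matrix_def vec_lambda_beta
    by (rule real_polynomial_function_det) (simp only: vec_lambda_beta entry)
  with M show ?thesis
    unfolding matrix_polynomial_def kernel_matrix_def split_def
    by (auto intro!: real_polynomial_function_sum real_polynomial_function.intros(4)
        real_polynomial_function_det)
qed

text \<open>The factor \<open>2\<close> is there because each selected row contributes once to the determinant and once
  to the Cramer matrix. Overwriting a column does not disturb the degrees of the rows: the new entry is
  \<open>0\<close> in the rows of \<open>J\<close> and a constant in the unit rows, which have degree \<open>0\<close>.\<close>

lemma homogeneous_polynomial_kernel_matrix:
  fixes A :: "real^'n \<Rightarrow> real^'k^'m"
  assumes A: "\<And>i j. homogeneous_polynomial (h i) (\<lambda>\<xi>. A \<xi> $ i $ j)"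
    and w: "\<And>f J. card J = r \<Longrightarrow> homogeneous_polynomial (e f J) (w f J)"
    and deg: "\<And>f J. card J = r \<Longrightarrow> e f J + 2 * (\<Sum>i\<in>J. h (f i)) = d"
  shows "homogeneous_polynomial d (\<lambda>\<xi>. kernel_matrix (\<lambda>f J. w f J \<xi>) r (A \<xi>) $ k $ l)"
proof -
  have row: "homogeneous_polynomial (if i \<in> J then h (f i) else 0)
      (\<lambda>\<xi>. row_completion (A \<xi>) f J $ i $ j)" for f J i j
    by (auto simp: row_completion_def A homogeneous_polynomial_const)
  have sum_eq: "(\<Sum>i\<in>UNIV. if i \<in> J then h (f i) else 0) = (\<Sum>i\<in>J. h (f i))" for f and J :: "'k set"
    by (simp add: sum.If_cases)
  have det: "homogeneous_polynomial (\<Sum>i\<in>J. h (f i)) (\<lambda>\<xi>. det (row_completion (A \<xi>) f J))" for f J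
    using homogeneous_polynomial_det[OF row] by (simp add: sum_eq)
  have entry: "homogeneous_polynomial (if i \<in> J then h (f i) else 0)
      (\<lambda>\<xi>. if j = k then if i = l \<and> i \<notin> J then 1 else 0 else row_completion (A \<xi>) f J $ i $ j)" for f J i j
    using row[of i J f j]
    by (cases "j = k") (simp_all add: homogeneous_polynomial_0 homogeneous_polynomial_const)
  have "homogeneous_polynomial (\<Sum>i\<in>UNIV. if i \<in> J then h (f i) else 0)
      (\<lambda>\<xi>. cramer_matrix (A \<xi>) f J $ k $ l)" for f J
    unfolding cramer_matrix_def vec_lambda_beta
    by (rule homogeneous_polynomial_det) (simp only: vec_lambda_beta entry)
  then have cramer: "homogeneous_polynomial (\<Sum>i\<in>J. h (f i)) (\<lambda>\<xi>. cramer_matrix (A \<xi>) f J $ k $ l)" for f J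
    by (simp add: sum_eq)
  have "homogeneous_polynomial d
      (\<lambda>\<xi>. w f J \<xi> * det (row_completion (A \<xi>) f J) * cramer_matrix (A \<xi>) f J $ k $ l)"
    if "card J = r" for f J
    using homogeneous_polynomial_mult[OF homogeneous_polynomial_mult[OF w[OF that] det] cramer, of f f J f J]
      deg[OF that, of f] by (simp add: mult_2 add.assoc)
  then show ?thesis
    unfolding kernel_matrix_def by (auto intro!: homogeneous_polynomial_sum simp: split_def)
qed

section \<open>Kernels of polynomial matrices\<close>

theorem theorem1:
  fixes A :: "real^'n \<Rightarrow> real^'k^'m"
  assumes "matrix_polynomial A"
  shows "(\<exists>B :: real^'n \<Rightarrow> real^'k^'k. matrix_polynomial B \<and>
            (\<forall>\<xi>\<in>max_rank_set A. {v. A \<xi> *v v = 0} = range ((*v) (B \<xi>)))) \<and>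
         (\<forall>h :: 'm \<Rightarrow> nat. (\<forall>i j. homogeneous_polynomial (h i) (\<lambda>\<xi>. A \<xi> $ i $ j)) \<longrightarrow>
            (\<exists>B :: real^'n \<Rightarrow> real^'k^'k. matrix_polynomial B \<and>
               (\<forall>\<xi>\<in>max_rank_set A. \<xi> \<noteq> 0 \<or> 2 * generic_rank A * Max (range h) = 0 \<longrightarrow>
                  {v. A \<xi> *v v = 0} = range ((*v) (B \<xi>))) \<and>
               (\<forall>i j. homogeneous_polynomial (2 * generic_rank A * Max (range h))
                        (\<lambda>\<xi>. B \<xi> $ i $ j))))"
proof (intro conjI allI impI)
  let ?r = "generic_rank A"
  have rank: "rank (A \<xi>) = ?r" if "\<xi> \<in> max_rank_set A" for \<xi>
    using that by (simp add: max_rank_set_def)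
  show "\<exists>B :: real^'n \<Rightarrow> real^'k^'k. matrix_polynomial B \<and>
            (\<forall>\<xi>\<in>max_rank_set A. {v. A \<xi> *v v = 0} = range ((*v) (B \<xi>)))"
  proof (intro exI conjI ballI)
    show "matrix_polynomial (\<lambda>\<xi>. kernel_matrix (\<lambda>_ _. 1) ?r (A \<xi>))"
      using assms by (rule matrix_polynomial_kernel_matrix)
    show "{v. A \<xi> *v v = 0} = range ((*v) (kernel_matrix (\<lambda>_ _. 1) ?r (A \<xi>)))"
      if "\<xi> \<in> max_rank_set A" for \<xi>
      using kernel_eq_range_kernel_matrix[of "A \<xi>" "\<lambda>_ _. 1"] rank[OF that] by simp
  qed
  fix h :: "'m \<Rightarrow> nat"
  assume "\<forall>i j. homogeneous_polynomial (h i) (\<lambda>\<xi>. A \<xi> $ i $ j)"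
  then have hom: "homogeneous_polynomial (h i) (\<lambda>\<xi>. A \<xi> $ i $ j)" for i j
    by blast
  let ?H = "Max (range h)"
  define m where "m f J = ?r * ?H - (\<Sum>i\<in>J. h (f i))" for f :: "'k \<Rightarrow> 'm" and J
  define B where "B \<xi> = kernel_matrix (\<lambda>f J. ((norm \<xi>)\<^sup>2) ^ m f J) ?r (A \<xi>)" for \<xi>
  (* Without this bound the truncated subtraction in the exponent would lose degrees. *)
  have "(\<Sum>i\<in>J. h (f i)) \<le> ?r * ?H" if "card J = ?r" for f :: "'k \<Rightarrow> 'm" and J
    using sum_bounded_above[of J "\<lambda>i. h (f i)" ?H] that by simp
  then have deg: "2 * m f J + 2 * (\<Sum>i\<in>J. h (f i)) = 2 * ?r * ?H" if "card J = ?r" for f J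
    using that by (simp add: m_def diff_mult_distrib2)
  have hB: "homogeneous_polynomial (2 * ?r * ?H) (\<lambda>\<xi>. B \<xi> $ k $ l)" for k l
    unfolding B_def
    by (rule homogeneous_polynomial_kernel_matrix[OF hom homogeneous_polynomial_norm_power deg])
  show "\<exists>B :: real^'n \<Rightarrow> real^'k^'k. matrix_polynomial B \<and>
               (\<forall>\<xi>\<in>max_rank_set A. \<xi> \<noteq> 0 \<or> 2 * ?r * ?H = 0 \<longrightarrow>
                  {v. A \<xi> *v v = 0} = range ((*v) (B \<xi>))) \<and>
               (\<forall>i j. homogeneous_polynomial (2 * ?r * ?H) (\<lambda>\<xi>. B \<xi> $ i $ j))"
  proof (intro exI conjI ballI impI allI)
    show "matrix_polynomial B"
      unfolding matrix_polynomial_def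
      using hB homogeneous_polynomial_imp_real_polynomial_function by blast
    show "{v. A \<xi> *v v = 0} = range ((*v) (B \<xi>))"
      if "\<xi> \<in> max_rank_set A" "\<xi> \<noteq> 0 \<or> 2 * ?r * ?H = 0" for \<xi>
    proof -
      (* At the origin the hypothesis makes the total degree zero, so all exponents vanish and every
         weight equals 0 ^ 0 = 1. *)
      have "((norm \<xi>)\<^sup>2) ^ m f J > 0" for f J
        using that(2) by (auto simp: m_def)
      then show ?thesis
        using kernel_eq_range_kernel_matrix[of "A \<xi>" "\<lambda>f J. ((norm \<xi>)\<^sup>2) ^ m f J"] rank[OF that(1)]
        by (simp add: B_def)
    qed
    show "homogeneous_polynomial (2 * ?r * ?H) (\<lambda>\<xi>. B \<xi> $ k $ l)" for k l
      by (rule hB)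
  qed
qed

end
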